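(* Let $n$ and $l$ be positive integers, and let the function $f(z)$ given by $$f(z) = a_n z^n + a_{n+l} z^{n+l} + a_{n+l+1} z^{n+l+1} + \ldots \qquad (a_n, a_{n+l} \neq 0)$$ be analytic in $\mathbb{U}$ and $f(z) \neq 0$ for $z\in\mathbb{U}\setminus\{0\}$. If there exists a point $z_0\in\mathbb{U}\setminus\{0\}$ such that $$\min_{|z| \leq |z_0|} |f(z)| = |f(z_0)|,$$ then $$\frac{z_0 f'(z_0)}{f(z_0)} = n-m$$ and $$(n-m)\left( \mathrm{Re}\,\frac{z_0 f''(z_0)}{f'(z_0)} + 1 \right) \leq (n-m)^2,$$ where $m$ is a real number satisfying $$m \geq l\, \frac{|a_n z_0^n - f(z_0)|^2}{|a_n z_0^n|^2 - |f(z_0)|^2} \geq l\, \frac{|a_n z_0^n| - |f(z_0)|}{|a_n z_0^n| + |f(z_0)|}.$$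
   Context: $\mathbb{U} = \{z\in\mathbb{C} : |z|<1\}$ is the open unit disk. The coefficients $a_k$ are complex numbers.
   Formalization: As stated, the minimum over |z| ≤ |z_0| can never be attained at z_0, since f(0) = 0 while f(z_0) ≠ 0; the formal theorem assumes that |f| is minimal at z_0 over the closed disc or just over the circle |z| = |z_0|, so it covers the satisfiable circle case. *)

theory Defs
  imports "HOL-Complex_Analysis.Complex_Analysis"
begin

end

theory Submission
  imports Defs
begin

text \<open>
  The function \<open>g z = f z / z ^ n = a n + a (n + l) z ^ l + \<dots>\<close> has no zeros in the unit disc, and
  \<open>\<bar>g\<bar>\<close>, restricted to the circle through \<open>z0\<close>, is minimal at \<open>z0\<close>.  Put \<open>p = z0 f'(z0) / f(z0)\<close>
  and \<open>m = n - Re p\<close>; then \<open>m = - Re (z0 g'(z0) / g(z0))\<close>.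

  Moving along the circle, the function \<open>t \<mapsto> \<bar>f (z0 e\<^sup>i\<^sup>t)\<bar>\<^sup>2\<close> has a minimum at \<open>t = 0\<close>.  Its first
  derivative vanishes there, which says that \<open>p\<close> is real, and its second derivative is nonnegative,
  which after division by \<open>\<bar>f(z0)\<bar>\<^sup>2\<close> is the inequality on \<open>Re (z0 f''(z0) / f'(z0)) + 1\<close>
  (lemma \<open>norm_min_on_circle\<close>).

  Moving along the radius gives the lower bound on \<open>m\<close>; this is a boundary Schwarz lemma of Jack's
  type.  Write \<open>\<alpha> = a n\<close> and \<open>c = g z0\<close>.  Since \<open>g\<close> has no zeros, \<open>\<bar>g\<bar> \<ge> \<bar>c\<bar>\<close> on the whole disc
  \<open>\<bar>z\<bar> \<le> \<bar>z0\<bar>\<close>, and \<open>\<bar>\<alpha>\<bar> > \<bar>c\<bar>\<close> because \<open>g\<close> is not constant.  The values of \<open>c / g\<close> therefore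
  lie in the closed unit disc; sending \<open>c / \<alpha>\<close>, its value at \<open>0\<close>, to \<open>0\<close> by a disc automorphism
  yields, up to a unimodular factor, the function \<open>c (g - \<alpha>) / (cnj \<alpha> g - \<bar>c\<bar>\<^sup>2)\<close>, which is
  bounded by \<open>1\<close>, has a zero of order at least \<open>l\<close> at \<open>0\<close>, and has modulus \<open>1\<close> at \<open>z0\<close>.  By the
  maximum principle it is at most \<open>(\<bar>z\<bar> / \<bar>z0\<bar>) ^ l\<close> in modulus (lemma \<open>schwarz_bound\<close>).  Equality
  at \<open>z0\<close> makes one radial derivative there have a sign, and this sign is the estimate for \<open>m\<close>
  (lemma \<open>jack_norm_min\<close>).
\<close>

section \<open>Calculus along curves\<close>

lemma has_real_derivative_inner:
  fixes u v :: "real \<Rightarrow> 'a::real_inner"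
  assumes "(u has_vector_derivative u') (at t)" "(v has_vector_derivative v') (at t)"
  shows "((\<lambda>t. u t \<bullet> v t) has_real_derivative (u t \<bullet> v' + u' \<bullet> v t)) (at t)"
proof -
  have "((\<lambda>t. u t \<bullet> v t) has_derivative (\<lambda>h. u t \<bullet> (h *\<^sub>R v') + (h *\<^sub>R u') \<bullet> v t)) (at t)"
    using assms unfolding has_vector_derivative_def by (rule has_derivative_inner)
  moreover have "(\<lambda>h. u t \<bullet> (h *\<^sub>R v') + (h *\<^sub>R u') \<bullet> v t) = (*) (u t \<bullet> v' + u' \<bullet> v t)"
    by (auto simp: fun_eq_iff algebra_simps)
  ultimately show ?thesis
    by (simp add: has_field_derivative_def)
qed

lemma has_real_derivative_norm_power2:
  fixes u :: "real \<Rightarrow> 'a::real_inner"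
  assumes "(u has_vector_derivative u') (at t)"
  shows "((\<lambda>t. (norm (u t))\<^sup>2) has_real_derivative 2 * (u t \<bullet> u')) (at t)"
  using has_real_derivative_inner[OF assms assms]
  by (simp add: power2_norm_eq_inner inner_commute)

lemma second_derivative_nonneg_at_min:
  fixes \<phi> :: "real \<Rightarrow> real"
  assumes d1: "\<And>t. (\<phi> has_real_derivative \<phi>' t) (at t)"
    and d2: "(\<phi>' has_real_derivative d) (at x)"
    and min: "\<And>t. \<phi> x \<le> \<phi> t"
  shows "\<phi>' x = 0" "d \<ge> 0"
proof -
  show zero: "\<phi>' x = 0"
    using DERIV_local_min[OF d1, of 1] min by auto
  show "d \<ge> 0"
  proof (rule ccontr)
    assume "\<not> d \<ge> 0"
    then obtain e where e: "e > 0" "\<And>h. 0 < h \<Longrightarrow> h < e \<Longrightarrow> \<phi>' (x + h) < 0"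
      using DERIV_neg_dec_right[OF d2] zero by auto
    have "\<phi> (x + e / 2) < \<phi> x"
    proof (rule DERIV_neg_imp_decreasing_open[where a = x])
      show "x < x + e / 2" using e by simp
      show "\<exists>y. (\<phi> has_real_derivative y) (at t) \<and> y < 0" if "x < t" "t < x + e / 2" for t
        using d1[of t] e(2)[of "t - x"] that e(1) by auto
      show "continuous_on {x..x + e / 2} \<phi>"
        using d1 DERIV_continuous continuous_at_imp_continuous_on by blast
    qed
    with min[of "x + e / 2"] show False by simp
  qed
qed

section \<open>Minimum of the modulus on a circle\<close>

text \<open>
  Along \<open>z = z0 e\<^sup>i\<^sup>t\<close> the derivative of \<open>F z\<close> with respect to \<open>t\<close> is \<open>\<i> z F'(z)\<close>, and the second
  derivative is \<open>- (z F'(z) + z\<^sup>2 F''(z))\<close>.  The first- and second-order conditions for the minimum of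
  \<open>\<bar>F z\<bar>\<^sup>2\<close> are the two conclusions,
  after division by \<open>\<bar>F z0\<bar>\<^sup>2\<close>.  When \<open>F' z0 = 0\<close> the second one is trivial.
\<close>

lemma norm_min_on_circle:
  fixes F :: "complex \<Rightarrow> complex"
  assumes hol: "F holomorphic_on S" and S: "open S" "sphere 0 (norm z0) \<subseteq> S"
    and nz: "F z0 \<noteq> 0"
    and min: "\<And>z. norm z = norm z0 \<Longrightarrow> norm (F z0) \<le> norm (F z)"
  defines "p \<equiv> z0 * deriv F z0 / F z0"
  shows "Im p = 0"
    and "Re p * (Re (z0 * deriv (deriv F) z0 / deriv F z0) + 1) \<le> (Re p)\<^sup>2"
proof -
  define \<gamma> :: "real \<Rightarrow> complex" where "\<gamma> = (\<lambda>t. z0 * exp (\<i> * of_real t))"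
  have \<gamma>0: "\<gamma> 0 = z0" by (simp add: \<gamma>_def)
  have norm\<gamma>: "norm (\<gamma> t) = norm z0" for t
    by (simp add: \<gamma>_def norm_mult)
  have inS: "\<gamma> t \<in> S" for t
    using S norm\<gamma> by (auto simp: subset_iff)
  have d\<gamma>: "(\<gamma> has_vector_derivative (\<i> * \<gamma> t)) (at t)" for t
    unfolding \<gamma>_def
    by (rule has_vector_derivative_real_field) (auto intro!: derivative_eq_intros)
  define F1 where "F1 = (\<lambda>z. z * deriv F z)"
  define F2 where "F2 = (\<lambda>z. z * deriv F z + z\<^sup>2 * deriv (deriv F) z)"
  have dF: "(F has_field_derivative deriv F z) (at z)" if "z \<in> S" for z
    using hol S(1) that by (rule holomorphic_derivI)
  have "deriv F holomorphic_on S"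
    using hol S(1) by (rule holomorphic_deriv)
  then have "(deriv F has_field_derivative deriv (deriv F) z) (at z)" if "z \<in> S" for z
    using S(1) that by (rule holomorphic_derivI)
  then have dF1: "(F1 has_field_derivative (deriv F z + z * deriv (deriv F) z)) (at z)"
    if "z \<in> S" for z
    unfolding F1_def using that by (auto intro!: derivative_eq_intros)
  define u where "u = (\<lambda>t. F (\<gamma> t))"
  define u1 where "u1 = (\<lambda>t. \<i> * F1 (\<gamma> t))"
  have du: "(u has_vector_derivative u1 t) (at t)" for t
    using field_vector_diff_chain_at[OF d\<gamma> dF[OF inS], of t]
    by (simp add: u_def u1_def F1_def o_def mult_ac)
  have du1: "(u1 has_vector_derivative (- F2 (\<gamma> t))) (at t)" for t
  proof -
    have "((F1 \<circ> \<gamma>) has_vector_derivative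
             (\<i> * \<gamma> t * (deriv F (\<gamma> t) + \<gamma> t * deriv (deriv F) (\<gamma> t)))) (at t)"
      by (rule field_vector_diff_chain_at[OF d\<gamma> dF1[OF inS]])
    then have "((\<lambda>t. \<i> * (F1 \<circ> \<gamma>) t) has_vector_derivative
             (\<i> * (\<i> * \<gamma> t * (deriv F (\<gamma> t) + \<gamma> t * deriv (deriv F) (\<gamma> t))))) (at t)"
      by (rule has_vector_derivative_mult_right)
    moreover have "\<i> * (\<i> * w * (x + w * y)) = - (w * x + w\<^sup>2 * y)" for w x y :: complex
      by (simp add: algebra_simps power2_eq_square)
    ultimately show ?thesis
      by (simp add: u1_def F2_def o_def)
  qed
  have d1: "((\<lambda>t. (norm (u t))\<^sup>2) has_real_derivative 2 * (u t \<bullet> u1 t)) (at t)" for t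
    by (rule has_real_derivative_norm_power2[OF du])
  have d2: "((\<lambda>t. 2 * (u t \<bullet> u1 t)) has_real_derivative
              2 * (u 0 \<bullet> (- F2 (\<gamma> 0)) + u1 0 \<bullet> u1 0)) (at 0)"
    by (rule DERIV_cmult[OF has_real_derivative_inner[OF du du1]])
  have "(norm (u 0))\<^sup>2 \<le> (norm (u t))\<^sup>2" for t
    by (rule power_mono) (auto simp: u_def \<gamma>0 norm\<gamma> intro: min)
  note mm = second_derivative_nonneg_at_min[OF d1 d2 this]
  define c where "c = F z0"
  have c: "c \<noteq> 0" "F z0 = c" using nz by (auto simp: c_def)
  have p: "F1 z0 = p * c" using c by (simp add: p_def F1_def)
  have inner_c: "(c * x) \<bullet> (c * y) = (norm c)\<^sup>2 * (x \<bullet> y)" for x y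
    unfolding inner_complex_def cmod_power2 by (simp add: algebra_simps power2_eq_square)
  have "(c * 1) \<bullet> (c * (\<i> * p)) = 0"
    using mm(1) by (simp add: u_def u1_def \<gamma>0 p c mult_ac)
  then show im: "Im p = 0"
    unfolding inner_c using c by (simp add: inner_complex_def)
  show "Re p * (Re (z0 * deriv (deriv F) z0 / deriv F z0) + 1) \<le> (Re p)\<^sup>2"
  proof (cases "deriv F z0 = 0")
    case True
    then show ?thesis by (simp add: p_def)
  next
    case False
    define s where "s = z0 * deriv (deriv F) z0 / deriv F z0"
    \<comment> \<open>Both sides of the second-order condition contain the factor \<open>\<bar>c\<bar>\<^sup>2\<close>, which \<open>inner_c\<close> extracts.\<close>
    have F2: "F2 z0 = c * (p * (1 + s))"
      using False c by (simp add: F2_def s_def p_def field_simps power2_eq_square)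
    have "F2 (\<gamma> 0) \<bullet> u 0 \<le> u1 0 \<bullet> u1 0"
      using mm(2) by (simp add: inner_commute)
    then have "(c * (p * (1 + s))) \<bullet> (c * 1) \<le> (c * (\<i> * p)) \<bullet> (c * (\<i> * p))"
      by (simp add: u_def u1_def \<gamma>0 F2 p c mult_ac)
    then have "(p * (1 + s)) \<bullet> 1 \<le> (\<i> * p) \<bullet> (\<i> * p)"
      unfolding inner_c using c by simp
    then show ?thesis
      unfolding s_def[symmetric] using im
      by (simp add: inner_complex_def power2_eq_square algebra_simps)
  qed
qed

section \<open>A boundary Schwarz lemma for functions without zeros\<close>

text \<open>The maximum principle for \<open>1 / g\<close>.\<close>

lemma norm_ge_on_disc_of_sphere:
  fixes g :: "complex \<Rightarrow> complex"
  assumes hol: "g holomorphic_on S" and S: "cball 0 r \<subseteq> S"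
    and nz: "\<And>z. z \<in> S \<Longrightarrow> g z \<noteq> 0" and "\<mu> > 0"
    and min: "\<And>z. norm z = r \<Longrightarrow> \<mu> \<le> norm (g z)"
    and z: "norm z \<le> r"
  shows "\<mu> \<le> norm (g z)"
proof -
  have hol': "(\<lambda>z. 1 / g z) holomorphic_on S"
    using hol nz by (intro holomorphic_intros)
  have "norm (1 / g z) \<le> 1 / \<mu>"
  proof (rule maximum_modulus_frontier[where S = "cball 0 r" and f = "\<lambda>z. 1 / g z"])
    show "(\<lambda>z. 1 / g z) holomorphic_on interior (cball 0 r)"
      by (rule holomorphic_on_subset[OF hol']) (use S interior_subset in blast)
    show "continuous_on (closure (cball 0 r)) (\<lambda>z. 1 / g z)"
      by (rule continuous_on_subset[OF holomorphic_on_imp_continuous_on[OF hol']]) (use S in auto)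
    show "norm (1 / g w) \<le> 1 / \<mu>" if "w \<in> frontier (cball 0 r)" for w
      using that min[of w] \<open>\<mu> > 0\<close> by (auto simp: norm_divide divide_simps)
  qed (use z in auto)
  then show ?thesis
    using nz[of z] S z \<open>\<mu> > 0\<close> by (auto simp: norm_divide divide_simps)
qed

lemma norm_center_gt_min_on_sphere:
  fixes g :: "complex \<Rightarrow> complex"
  assumes hol: "g holomorphic_on ball 0 R" and r: "0 < r" "r < R"
    and nz: "\<And>z. z \<in> ball 0 R \<Longrightarrow> g z \<noteq> 0" and "\<mu> > 0"
    and min: "\<And>z. norm z = r \<Longrightarrow> \<mu> \<le> norm (g z)"
    and nonconst: "\<not> g constant_on ball 0 R"
  shows "\<mu> < norm (g 0)"
proof (rule ccontr)
  assume "\<not> \<mu> < norm (g 0)"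
  then have le: "norm (g 0) \<le> norm (g z)" if "norm z \<le> r" for z
    using norm_ge_on_disc_of_sphere[OF hol _ nz \<open>\<mu> > 0\<close> min that] r by force
  have "(\<lambda>z. 1 / g z) constant_on ball 0 R"
  proof (rule maximum_modulus_principle[where U = "ball 0 r" and \<xi> = 0])
    show "(\<lambda>z. 1 / g z) holomorphic_on ball 0 R"
      using hol nz by (intro holomorphic_intros)
    show "norm (1 / g z) \<le> norm (1 / g 0)" if "z \<in> ball 0 r" for z
      using le[of z] that nz[of 0] r by (auto simp: norm_divide intro!: divide_left_mono mult_pos_pos)
  qed (use r in auto)
  then have "g constant_on ball 0 R"
    unfolding constant_on_def by (metis divide_divide_eq_right div_by_1 mult_1)
  with nonconst show False ..
qed

text \<open>
  For \<open>\<bar>w\<bar> \<ge> \<bar>c\<bar> > 0\<close> and \<open>\<bar>\<alpha>\<bar> > \<bar>c\<bar>\<close> this says that \<open>c (w - \<alpha>) / (cnj \<alpha> w - \<bar>c\<bar>\<^sup>2)\<close>,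
  which is a disc automorphism applied to \<open>c / w\<close>, has modulus at most \<open>1\<close>, with equality for
  \<open>\<bar>w\<bar> = \<bar>c\<bar>\<close>.
\<close>

lemma disc_automorphism_defect:
  fixes w c \<alpha> :: complex
  shows "(norm (cnj \<alpha> * w - of_real ((norm c)\<^sup>2)))\<^sup>2 - (norm c)\<^sup>2 * (norm (w - \<alpha>))\<^sup>2
         = ((norm \<alpha>)\<^sup>2 - (norm c)\<^sup>2) * ((norm w)\<^sup>2 - (norm c)\<^sup>2)"
proof -
  have "(norm (cnj \<alpha> * w - of_real k))\<^sup>2 - k * (norm (w - \<alpha>))\<^sup>2
         = ((norm \<alpha>)\<^sup>2 - k) * ((norm w)\<^sup>2 - k)" for k :: real
    unfolding cmod_power2 by (simp add: algebra_simps power2_eq_square)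
  then show ?thesis by blast
qed

text \<open>
  Dividing \<open>c (g - \<alpha>) / (cnj \<alpha> g - \<bar>c\<bar>\<^sup>2)\<close> by \<open>z ^ l\<close> leaves a holomorphic function, so the bound
  \<open>1\<close> on the boundary circle improves inside the disc by the factor \<open>(\<bar>z\<bar> / r) ^ l\<close>, as in the
  Schwarz lemma.
\<close>

lemma schwarz_bound:
  fixes g q :: "complex \<Rightarrow> complex" and c \<alpha> :: complex
  assumes hol: "g holomorphic_on S" "q holomorphic_on S" and S: "cball 0 r \<subseteq> S" and r: "r > 0"
    and nz: "\<And>z. z \<in> S \<Longrightarrow> g z \<noteq> 0"
    and g: "\<And>z. z \<in> S \<Longrightarrow> g z = \<alpha> + z ^ l * q z"
    and c: "c \<noteq> 0" "norm c < norm \<alpha>"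
    and min: "\<And>z. norm z = r \<Longrightarrow> norm c \<le> norm (g z)"
    and z: "norm z \<le> r"
  shows "norm c * norm (g z - \<alpha>) \<le> (norm z / r) ^ l * norm (cnj \<alpha> * g z - of_real ((norm c)\<^sup>2))"
proof -
  define H where "H = (\<lambda>z. cnj \<alpha> * g z - of_real ((norm c)\<^sup>2))"
  have ge: "norm c \<le> norm (g w)" if "norm w \<le> r" for w
    by (rule norm_ge_on_disc_of_sphere[OF hol(1) S nz _ min that]) (use c in auto)
  have Hnz: "H w \<noteq> 0" if "norm w \<le> r" for w
  proof
    assume "H w = 0"
    then have "norm (cnj \<alpha> * g w) = norm (of_real ((norm c)\<^sup>2) :: complex)"
      by (simp add: H_def)
    then have "norm \<alpha> * norm (g w) = norm c * norm c"
      by (simp add: norm_mult power2_eq_square)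
    moreover have "norm c * norm c < norm \<alpha> * norm (g w)"
      using c ge[OF that] by (intro mult_less_le_imp_less) auto
    ultimately show False by simp
  qed
  have le: "norm c * norm (g w - \<alpha>) \<le> norm (H w)" if "norm w \<le> r" for w
  proof (rule power2_le_imp_le)
    have "0 \<le> ((norm \<alpha>)\<^sup>2 - (norm c)\<^sup>2) * ((norm (g w))\<^sup>2 - (norm c)\<^sup>2)"
      using ge[OF that] c by (intro mult_nonneg_nonneg) (auto intro: power_mono)
    then show "(norm c * norm (g w - \<alpha>))\<^sup>2 \<le> (norm (H w))\<^sup>2"
      using disc_automorphism_defect[of \<alpha> "g w" c] by (simp add: H_def power_mult_distrib)
  qed auto
  have holH: "H holomorphic_on S"
    unfolding H_def using hol by (intro holomorphic_intros)
  have holQ: "(\<lambda>z. q z / H z) holomorphic_on cball 0 r"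
    using Hnz by (intro holomorphic_intros holomorphic_on_subset[OF holH S]
        holomorphic_on_subset[OF hol(2) S]) auto
  have "norm (q z / H z) \<le> 1 / (norm c * r ^ l)"
  proof (rule maximum_modulus_frontier[where S = "cball 0 r" and f = "\<lambda>z. q z / H z"])
    show "(\<lambda>z. q z / H z) holomorphic_on interior (cball 0 r)"
      by (rule holomorphic_on_subset[OF holQ interior_subset])
    show "continuous_on (closure (cball 0 r)) (\<lambda>z. q z / H z)"
      using holomorphic_on_imp_continuous_on[OF holQ] by simp
    show "norm (q w / H w) \<le> 1 / (norm c * r ^ l)" if "w \<in> frontier (cball 0 r)" for w
    proof -
      have w: "norm w = r" using that by auto
      have "g w - \<alpha> = w ^ l * q w" using g[of w] S w by auto
      then have "norm c * (r ^ l * norm (q w)) \<le> norm (H w)"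
        using le[of w] w by (simp add: norm_mult norm_power)
      then show ?thesis
        using Hnz[of w] w c r by (simp add: norm_divide divide_simps mult_ac)
    qed
  qed (use z in auto)
  then have *: "norm c * r ^ l * norm (q z) \<le> norm (H z)"
    using Hnz[OF z] c r by (simp add: norm_divide divide_simps mult_ac)
  have "g z - \<alpha> = z ^ l * q z" using g[of z] S z by auto
  then have "norm c * norm (g z - \<alpha>) = (norm z / r) ^ l * (norm c * r ^ l * norm (q z))"
    using r by (simp add: norm_mult norm_power power_divide)
  also have "\<dots> \<le> (norm z / r) ^ l * norm (H z)"
    using * r by (intro mult_left_mono) auto
  finally show ?thesis by (simp add: H_def)
qed

text \<open>
  Squaring \<open>schwarz_bound\<close> at \<open>t z0\<close> and rewriting it with \<open>disc_automorphism_defect\<close> shows that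
  the real function \<open>D\<close> below is nonnegative on \<open>[0, 1]\<close>.  It vanishes at \<open>t = 1\<close>, so its derivative
  there is at most \<open>0\<close>, and this is the assertion.
\<close>

lemma jack_norm_min:
  fixes g q :: "complex \<Rightarrow> complex"
  assumes hol: "g holomorphic_on S" "q holomorphic_on S"
    and S: "open S" "cball 0 (norm z0) \<subseteq> S" and z0: "z0 \<noteq> 0"
    and nz: "\<And>z. z \<in> S \<Longrightarrow> g z \<noteq> 0"
    and g: "\<And>z. z \<in> S \<Longrightarrow> g z = \<alpha> + z ^ l * q z"
    and lt: "norm (g z0) < norm \<alpha>"
    and min: "\<And>z. norm z = norm z0 \<Longrightarrow> norm (g z0) \<le> norm (g z)"
  shows "real l * (norm (\<alpha> - g z0))\<^sup>2
         \<le> - Re (z0 * deriv g z0 / g z0) * ((norm \<alpha>)\<^sup>2 - (norm (g z0))\<^sup>2)"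
proof -
  define c where "c = g z0"
  define s where "s = z0 * deriv g z0 / g z0"
  define K where "K = (norm \<alpha>)\<^sup>2 - (norm c)\<^sup>2"
  have z0S: "z0 \<in> S" using S by auto
  have c: "c \<noteq> 0" using nz[OF z0S] by (simp add: c_def)
  define v where "v = (\<lambda>t::real. g (of_real t * z0))"
  have v1: "v 1 = c" by (simp add: v_def c_def)
  have "(v has_vector_derivative (z0 * deriv g z0)) (at 1)"
  proof -
    have "((\<lambda>t::real. of_real t * z0) has_vector_derivative z0) (at 1)"
      by (rule has_vector_derivative_real_field) (auto intro!: derivative_eq_intros)
    moreover have "(g has_field_derivative deriv g z0) (at (of_real 1 * z0))"
      using holomorphic_derivI[OF hol(1) S(1) z0S] by simp
    ultimately show ?thesis
      unfolding v_def using field_vector_diff_chain_at by (fastforce simp: o_def)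
  qed
  moreover have "z0 * deriv g z0 = c * s"
    using c by (simp add: s_def c_def)
  ultimately have dv: "(v has_vector_derivative (c * s)) (at 1)"
    by simp
  define D where "D = (\<lambda>t::real. t ^ (2 * l) * (K * ((norm (v t))\<^sup>2 - (norm c)\<^sup>2))
                        - (norm c)\<^sup>2 * (norm (v t - \<alpha>))\<^sup>2 * (1 - t ^ (2 * l)))"
  have D1: "D 1 = 0" by (simp add: D_def v1)
  have Dnonneg: "D t \<ge> 0" if t: "0 \<le> t" "t \<le> 1" for t
  proof -
    have "norm (of_real t * z0) \<le> norm z0"
      using t by (simp add: norm_mult mult_left_le_one_le)
    then have "norm c * norm (v t - \<alpha>) \<le> (norm (of_real t * z0) / norm z0) ^ l
                 * norm (cnj \<alpha> * v t - of_real ((norm c)\<^sup>2))"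
      unfolding v_def
      by (intro schwarz_bound[OF hol S(2) _ nz g c]) (use z0 lt min in \<open>auto simp: c_def\<close>)
    also have "norm (of_real t * z0) / norm z0 = t"
      using t z0 by (simp add: norm_mult)
    finally have "(norm c * norm (v t - \<alpha>))\<^sup>2
                  \<le> (t ^ l * norm (cnj \<alpha> * v t - of_real ((norm c)\<^sup>2)))\<^sup>2"
      by (intro power_mono) auto
    also have "\<dots> = t ^ (2 * l) * (norm (cnj \<alpha> * v t - of_real ((norm c)\<^sup>2)))\<^sup>2"
      by (simp add: power_mult_distrib power_mult[symmetric] mult.commute)
    also have "(norm (cnj \<alpha> * v t - of_real ((norm c)\<^sup>2)))\<^sup>2
               = K * ((norm (v t))\<^sup>2 - (norm c)\<^sup>2) + (norm c)\<^sup>2 * (norm (v t - \<alpha>))\<^sup>2"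
      using disc_automorphism_defect[of \<alpha> "v t" c] by (simp add: K_def)
    finally show ?thesis
      by (simp add: D_def algebra_simps power_mult_distrib)
  qed
  \<comment> \<open>The factors \<open>1 - t ^ (2 * l)\<close> and \<open>\<bar>v t\<bar>\<^sup>2 - \<bar>c\<bar>\<^sup>2\<close> vanish at \<open>t = 1\<close>, so only their derivatives
      contribute to the derivative of \<open>D\<close> there.\<close>
  define D' where "D' = 2 * K * (c \<bullet> (c * s)) + 2 * real l * (norm c)\<^sup>2 * (norm (c - \<alpha>))\<^sup>2"
  have dv\<alpha>: "((\<lambda>t. v t - \<alpha>) has_vector_derivative (c * s)) (at 1)"
    using dv by (auto intro!: derivative_eq_intros)
  have dD: "(D has_real_derivative D') (at 1)"
    unfolding D_def
    by (rule derivative_eq_intros has_real_derivative_norm_power2[OF dv]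
        has_real_derivative_norm_power2[OF dv\<alpha>] refl)+
      (simp add: v1 D'_def algebra_simps)
  have "D' \<le> 0"
  proof (rule ccontr)
    assume "\<not> D' \<le> 0"
    then obtain d where d: "d > 0" "\<And>h. 0 < h \<Longrightarrow> h < d \<Longrightarrow> D (1 - h) < D 1"
      using DERIV_pos_inc_left[OF dD] by auto
    define h where "h = min (d / 2) 1"
    have "0 < h" "h < d" "h \<le> 1" using d(1) by (auto simp: h_def)
    then show False
      using d(2)[of h] Dnonneg[of "1 - h"] D1 by simp
  qed
  moreover have "c \<bullet> (c * s) = (norm c)\<^sup>2 * Re s"
    unfolding inner_complex_def cmod_power2 by (simp add: algebra_simps power2_eq_square)
  ultimately have "(norm c)\<^sup>2 * (K * Re s + real l * (norm (c - \<alpha>))\<^sup>2) \<le> 0"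
    by (simp add: D'_def algebra_simps)
  then have "K * Re s + real l * (norm (c - \<alpha>))\<^sup>2 \<le> 0"
    using c by (simp add: mult_le_0_iff)
  then show ?thesis
    by (simp add: K_def s_def c_def norm_minus_commute algebra_simps)
qed

section \<open>The quotient by the leading power\<close>

lemma sums_div_power:
  fixes b :: "nat \<Rightarrow> complex"
  assumes "(\<lambda>k. b k * z ^ (N + k)) sums s" "z \<noteq> 0"
  shows "(\<lambda>k. b k * z ^ k) sums (s / z ^ N)"
  using sums_divide[OF assms(1), of "z ^ N"] assms(2) by (simp add: power_add)

text \<open>
  The quotient \<open>(f z - a n z ^ n) / z ^ (n + l)\<close> extends holomorphically to \<open>0\<close>, being there as
  elsewhere the sum of the power series with coefficients \<open>a (n + l + k)\<close>.
\<close>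

lemma factor_leading_power:
  fixes a :: "nat \<Rightarrow> complex"
  assumes sums: "\<And>z. z \<in> ball 0 1 \<Longrightarrow>
      (\<lambda>k. a (n + l + k) * z ^ (n + l + k)) sums (f z - a n * z ^ n)"
  obtains q where "q holomorphic_on ball 0 1" "q 0 = a (n + l)"
    "\<And>z. z \<in> ball 0 1 \<Longrightarrow> z \<noteq> 0 \<Longrightarrow> f z = z ^ n * (a n + z ^ l * q z)"
proof -
  define q where "q = (\<lambda>z. if z = 0 then a (n + l) else (f z - a n * z ^ n) / z ^ (n + l))"
  have "(\<lambda>k. a (n + l + k) * z ^ k) sums q z" if "z \<in> ball 0 1" for z
    using sums_div_power[OF sums[OF that]] powser_sums_zero[of "\<lambda>k. a (n + l + k)"]
    by (cases "z = 0") (auto simp: q_def)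
  then have "q holomorphic_on ball 0 1"
    by (intro power_series_holomorphic) auto
  moreover have "q 0 = a (n + l)" by (simp add: q_def)
  moreover have "f z = z ^ n * (a n + z ^ l * q z)" if "z \<noteq> 0" for z
    using that by (simp add: q_def power_add field_simps)
  ultimately show thesis by (rule that)
qed

lemma norm_quotient_bound:
  fixes A B :: complex
  assumes "norm B < norm A"
  shows "(norm A - norm B) / (norm A + norm B) \<le> (norm (A - B))\<^sup>2 / ((norm A)\<^sup>2 - (norm B)\<^sup>2)"
proof -
  have pos: "norm A + norm B > 0" "norm A - norm B > 0"
    using assms norm_ge_zero[of B] by linarith+
  have eq: "(norm A)\<^sup>2 - (norm B)\<^sup>2 = (norm A - norm B) * (norm A + norm B)"
    by (simp add: algebra_simps power2_eq_square)
  have "(norm A - norm B) / (norm A + norm B)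
        = (norm A - norm B)\<^sup>2 / ((norm A)\<^sup>2 - (norm B)\<^sup>2)"
    unfolding eq using pos by (simp add: power2_eq_square del: divide_divide_eq_left)
  also have "\<dots> \<le> (norm (A - B))\<^sup>2 / ((norm A)\<^sup>2 - (norm B)\<^sup>2)"
    using pos norm_triangle_ineq2[of A B] unfolding eq
    by (intro divide_right_mono power_mono) auto
  finally show ?thesis .
qed

theorem theorem1:
  fixes f :: "complex \<Rightarrow> complex"
    and a :: "nat \<Rightarrow> complex"
    and n l :: nat
    and z0 :: complex
  assumes "n \<ge> 1" and "l \<ge> 1"
    and "a n \<noteq> 0" and "a (n + l) \<noteq> 0"
    and "f analytic_on ball 0 1"
    and "\<And>z. z \<in> ball 0 1 \<Longrightarrow>
           (\<lambda>k. a (n + l + k) * z ^ (n + l + k)) sums (f z - a n * z ^ n)"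
    and "\<And>z. z \<in> ball 0 1 - {0} \<Longrightarrow> f z \<noteq> 0"
    and "z0 \<in> ball 0 1 - {0}"
    \<comment> \<open>The minimum over the closed disc alone is contradictory, because f 0 = 0;
        the minimum over the circle is weaker and satisfiable.\<close>
    and "(\<forall>z. norm z \<le> norm z0 \<longrightarrow> norm (f z0) \<le> norm (f z)) \<or>
         (\<forall>z. norm z = norm z0 \<longrightarrow> norm (f z0) \<le> norm (f z))"
  shows "\<exists>m :: real.
           z0 * deriv f z0 / f z0 = complex_of_real (real n - m) \<and>
           (real n - m) * (Re (z0 * deriv (deriv f) z0 / deriv f z0) + 1) \<le> (real n - m)\<^sup>2 \<and>
           m \<ge> real l * ((norm (a n * z0 ^ n - f z0))\<^sup>2 /
                  ((norm (a n * z0 ^ n))\<^sup>2 - (norm (f z0))\<^sup>2)) \<and>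
           real l * ((norm (a n * z0 ^ n - f z0))\<^sup>2 /
                  ((norm (a n * z0 ^ n))\<^sup>2 - (norm (f z0))\<^sup>2))
             \<ge> real l * ((norm (a n * z0 ^ n) - norm (f z0)) /
                  (norm (a n * z0 ^ n) + norm (f z0)))"
proof -
  have min: "norm (f z0) \<le> norm (f z)" if "norm z = norm z0" for z
    using assms(9) that by auto
  have z0: "z0 \<noteq> 0" "norm z0 < 1" "norm z0 > 0" "z0 \<in> ball 0 1"
    using assms(8) by auto
  have fz0: "f z0 \<noteq> 0" using assms(7,8) by blast
  have holf: "f holomorphic_on ball 0 1"
    using assms(5) by (rule analytic_imp_holomorphic)
  obtain q where q: "q holomorphic_on ball 0 1" "q 0 = a (n + l)"
    and fq: "\<And>z. z \<in> ball 0 1 \<Longrightarrow> z \<noteq> 0 \<Longrightarrow> f z = z ^ n * (a n + z ^ l * q z)"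
    using factor_leading_power[of a n l f] assms(6) by blast
  define g where "g = (\<lambda>z. a n + z ^ l * q z)"
  have fg: "f z = z ^ n * g z" if "z \<in> ball 0 1" "z \<noteq> 0" for z
    using fq[OF that] by (simp add: g_def)
  have g0: "g 0 = a n" using assms(2) by (simp add: g_def)
  have holg: "g holomorphic_on ball 0 1"
    unfolding g_def using q by (intro holomorphic_intros)
  have gnz: "g z \<noteq> 0" if "z \<in> ball 0 1" for z
    using assms(3) assms(7)[of z] fg[of z] g0 that by (cases "z = 0") auto
  \<comment> \<open>If \<open>g\<close> were constant, then \<open>q\<close> would vanish off \<open>0\<close> and, by continuity, also at \<open>0\<close>, where its
      value is the nonzero coefficient \<open>a (n + l)\<close>.\<close>
  have nonconst: "\<not> g constant_on ball 0 1"
  proof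
    assume "g constant_on ball 0 1"
    then have "g z = a n" if "z \<in> ball 0 1" for z
      using that g0 unfolding constant_on_def
      by (metis centre_in_ball zero_less_one)
    then have qz: "q z = 0" if "z \<in> ball 0 1 - {0}" for z
      using that by (auto simp: g_def)
    have "(q \<longlongrightarrow> q 0) (at 0)"
      using holomorphic_on_imp_continuous_on[OF q(1)]
      by (metis centre_in_ball continuous_on_eq_continuous_at isContD open_ball zero_less_one)
    moreover have "\<forall>\<^sub>F z in at 0. q z = 0"
      using qz by (intro eventually_at_ball'[of 1 0 UNIV, THEN eventually_mono]) auto
    then have "(q \<longlongrightarrow> 0) (at 0)" by (rule tendsto_eventually)
    ultimately have "q 0 = 0" using tendsto_unique[OF at_neq_bot] by blast
    with q(2) assms(4) show False by simp
  qed
  have ming: "norm (g z0) \<le> norm (g z)" if "norm z = norm z0" for z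
  proof -
    have "z \<in> ball 0 1" "z \<noteq> 0" using that z0 by auto
    then have "norm z0 ^ n * norm (g z0) \<le> norm z0 ^ n * norm (g z)"
      using min[OF that] fg[of z] fg[OF z0(4,1)] that by (simp add: norm_mult norm_power)
    then show ?thesis using z0 by simp
  qed
  have lt: "norm (g z0) < norm (a n)"
    using norm_center_gt_min_on_sphere[OF holg z0(3,2) gnz _ ming nonconst] gnz[OF z0(4)] g0
    by auto
  define p where "p = z0 * deriv f z0 / f z0"
  have circle: "Im p = 0"
    "Re p * (Re (z0 * deriv (deriv f) z0 / deriv f z0) + 1) \<le> (Re p)\<^sup>2"
    unfolding p_def
    by (rule norm_min_on_circle[OF holf open_ball _ fz0 min]; use z0 in auto)+
  have p_g: "p = of_nat n + z0 * deriv g z0 / g z0"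
  proof -
    have "((\<lambda>z. z ^ n * g z) has_field_derivative
            (of_nat n * z0 ^ (n - 1) * g z0 + z0 ^ n * deriv g z0)) (at z0)"
      by (auto intro!: derivative_eq_intros holomorphic_derivI[OF holg open_ball z0(4)])
    moreover have "\<forall>\<^sub>F z in nhds z0. z ^ n * g z = f z"
      using eventually_nhds_in_open[of "ball 0 1 - {0}" z0] z0
      by (auto elim!: eventually_mono simp: fg open_delete)
    ultimately have "deriv f z0 = of_nat n * z0 ^ (n - 1) * g z0 + z0 ^ n * deriv g z0"
      using DERIV_cong_ev[of z0 z0 "\<lambda>z. z ^ n * g z" f] by (auto intro!: DERIV_imp_deriv)
    moreover have "z0 * z0 ^ (n - 1) = z0 ^ n"
      using assms(1) by (simp add: power_eq_if)
    ultimately have "z0 * deriv f z0 = z0 ^ n * (of_nat n * g z0 + z0 * deriv g z0)"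
      by (simp add: algebra_simps)
    then show ?thesis
      using gnz[OF z0(4)] z0 fg[OF z0(4,1)] by (simp add: p_def field_simps)
  qed
  define m where "m = real n - Re p"
  have m: "m = - Re (z0 * deriv g z0 / g z0)"
    by (simp add: m_def p_g)
  have jack: "real l * (norm (a n - g z0))\<^sup>2 \<le> m * ((norm (a n))\<^sup>2 - (norm (g z0))\<^sup>2)"
    unfolding m
    by (rule jack_norm_min[OF holg q(1) open_ball _ z0(1) gnz _ lt ming])
      (use z0 in \<open>auto simp: g_def\<close>)
  define A where "A = a n * z0 ^ n"
  have A: "norm A = norm z0 ^ n * norm (a n)" "norm (f z0) = norm z0 ^ n * norm (g z0)"
    "norm (A - f z0) = norm z0 ^ n * norm (a n - g z0)"
    using fg[OF z0(4,1)]
    by (auto simp: A_def norm_mult norm_power right_diff_distrib[symmetric] mult.commute[of "a n"])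
  have ltA: "norm (f z0) < norm A"
    using lt z0 A by simp
  then have "(norm (f z0))\<^sup>2 < (norm A)\<^sup>2"
    by (intro power_strict_mono) auto
  moreover have "real l * (norm (A - f z0))\<^sup>2 \<le> m * ((norm A)\<^sup>2 - (norm (f z0))\<^sup>2)"
    using mult_left_mono[OF jack, of "(norm z0 ^ n)\<^sup>2"]
    by (simp add: A power_mult_distrib algebra_simps)
  ultimately have "real l * ((norm (A - f z0))\<^sup>2 / ((norm A)\<^sup>2 - (norm (f z0))\<^sup>2)) \<le> m"
    by (simp add: divide_simps)
  moreover have "real l * ((norm A - norm (f z0)) / (norm A + norm (f z0)))
      \<le> real l * ((norm (A - f z0))\<^sup>2 / ((norm A)\<^sup>2 - (norm (f z0))\<^sup>2))"
    using norm_quotient_bound[OF ltA] by (intro mult_left_mono) auto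
  moreover have "p = complex_of_real (real n - m)"
    using circle(1) by (simp add: m_def complex_eq_iff)
  moreover have "real n - m = Re p" by (simp add: m_def)
  ultimately show ?thesis
    using circle(2) unfolding A_def p_def by (intro exI[of _ m]) simp
qed

end
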